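(* Let $M\in\mathbb{C}^{p\times p}$ be nonsingular, let $\mathcal{A}\in\mathbb{C}^{m\times m\times p}$ have tubal index $k$, and let $\mathcal{B}\in\mathbb{C}^{m\times 1\times p}$. If $\mathcal{B}\in\mathscr{R}_M(\mathcal{A}^k)$, then $\mathcal{A}^{c,\dagger}*_M\mathcal{B}$ is the unique solution of $\mathcal{A}*_M\mathcal{X}=\mathcal{B}$ in $\mathscr{R}_M(\mathcal{A}^\dagger*_M\mathcal{A}^k)$.
   Context: Transform: for $\mathcal{A}\in\mathbb{C}^{m\times n\times p}$, $\tilde{\mathcal{A}}=\mathcal{A}\times_3 M\in\mathbb{C}^{m\times n\times p}$ is given by $(\tilde{\mathcal{A}})_{ijk}=\sum_{s=1}^p(\mathcal{A})_{ijs}M_{ks}$, and $\tilde{\mathcal{A}}^{(i)}=\tilde{\mathcal{A}}(:,:,i)$ is its $i$th frontal slice. Since $M$ is nonsingular, $\mathcal{A}\mapsto\tilde{\mathcal{A}}$ is a bijection. $M$-product: for $\mathcal{A}\in\mathbb{C}^{m\times n\times p}$, $\mathcal{B}\in\mathbb{C}^{n\times l\times p}$, $\mathcal{A}*_M\mathcal{B}$ is the unique $\mathcal{C}\in\mathbb{C}^{m\times l\times p}$ with $\tilde{\mathcal{C}}^{(i)}=\tilde{\mathcal{A}}^{(i)}\tilde{\mathcal{B}}^{(i)}$, $i=1,\dots,p$. The identity tensor $\mathcal{I}$ has $\tilde{\mathcal{I}}^{(i)}=I_m$ for all $i$; powers are taken with respect to $*_M$, with $\mathcal{A}^0=\mathcal{I}$.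 The conjugate transpose $\mathcal{A}^*$ is the tensor whose transform has $i$th frontal slice $(\tilde{\mathcal{A}}^{(i)})^{*}$ (matrix conjugate transpose). Range: $\mathscr{R}_M(\mathcal{A})=\{\mathcal{A}*_M\mathcal{Z}:\mathcal{Z}\in\mathbb{C}^{n\times 1\times p}\}$ for $\mathcal{A}\in\mathbb{C}^{m\times n\times p}$. Tubal index of $\mathcal{A}\in\mathbb{C}^{m\times m\times p}$: $k=\max_{1\le i\le p}\mathrm{ind}(\tilde{\mathcal{A}}^{(i)})$, where $\mathrm{ind}(A)$ is the least integer $k\ge 0$ with $\mathrm{rank}(A^k)=\mathrm{rank}(A^{k+1})$. Drazin inverse: for $\mathcal{A}$ of tubal index $k$, $\mathcal{A}^{\mathrm D}$ is the unique $\mathcal{X}\in\mathbb{C}^{m\times m\times p}$ with $\mathcal{X}*_M\mathcal{A}*_M\mathcal{X}=\mathcal{X}$, $\mathcal{A}*_M\mathcal{X}=\mathcal{X}*_M\mathcal{A}$ and $\mathcal{X}*_M\mathcal{A}^{k+1}=\mathcal{A}^k$. Moore–Penrose inverse: $\mathcal{A}^\dagger$ is the unique $\mathcal{X}$ with $\mathcal{A}*_M\mathcal{X}*_M\mathcal{A}=\mathcal{A}$, $\mathcal{X}*_M\mathcal{A}*_M\mathcal{X}=\mathcal{X}$, $(\mathcal{A}*_M\mathcal{X})^*=\mathcal{A}*_M\mathcal{X}$, $(\mathcal{X}*_M\mathcal{A})^*=\mathcal{X}*_M\mathcal{A}$. CMP inverse: $\mathcal{A}^{c,\dagger}=\mathcal{A}^\dagger*_M\mathcal{A}*_M\mathcal{A}^{\mathrm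 D}*_M\mathcal{A}*_M\mathcal{A}^\dagger$. *)

theory Defs
  imports "HOL-Analysis.Analysis"
begin

text \<open>
  An \<open>m \<times> n \<times> p\<close> complex tensor is an element \<open>A\<close> of \<open>complex^'p^'n^'m\<close>, with
  \<open>A $ i $ j $ k\<close> the entry at row \<open>i\<close>, column \<open>j\<close> and frontal slice \<open>k\<close>.  The finite
  types \<open>'m\<close>, \<open>'n\<close>, \<open>'p\<close> stand for arbitrary positive dimensions.
\<close>

definition frontal_slice :: "complex^'p^'n^'m \<Rightarrow> 'p \<Rightarrow> complex^'n^'m" where
  "frontal_slice A k = (\<chi> i j. A $ i $ j $ k)"

definition mtransform :: "complex^'p^'p \<Rightarrow> complex^'p^'n^'m \<Rightarrow> complex^'p^'n^'m" where
  "mtransform M A = (\<chi> i j k. \<Sum>s\<in>UNIV. A $ i $ j $ s * M $ k $ s)"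

abbreviation tslice :: "complex^'p^'p \<Rightarrow> complex^'p^'n^'m \<Rightarrow> 'p \<Rightarrow> complex^'n^'m" where
  "tslice M A k \<equiv> frontal_slice (mtransform M A) k"

text \<open>
  The transform is a bijection exactly when \<open>M\<close> is nonsingular; the definite descriptions
  below are meaningful only under that hypothesis.
\<close>

definition mprod ::
    "complex^'p^'n^'m \<Rightarrow> complex^'p^'p \<Rightarrow> complex^'p^'l^'n \<Rightarrow> complex^'p^'l^'m"
    ("(_ \<star>\<^bsub>_\<^esub> _)" [70, 0, 71] 70) where
  "A \<star>\<^bsub>M\<^esub> B = (THE C. \<forall>i. tslice M C i = tslice M A i ** tslice M B i)"

definition tensor_id :: "complex^'p^'p \<Rightarrow> complex^'p^'m^'m" where
  "tensor_id M = (THE I. \<forall>i. tslice M I i = mat 1)"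

text \<open>
  The library's \<open>^\<close> on vectors and matrices is the componentwise power, so powers with
  respect to \<open>\<star>\<close> and \<open>**\<close> are introduced separately.
\<close>

primrec tensor_pow :: "complex^'p^'p \<Rightarrow> complex^'p^'m^'m \<Rightarrow> nat \<Rightarrow> complex^'p^'m^'m" where
  "tensor_pow M A 0 = tensor_id M"
| "tensor_pow M A (Suc n) = A \<star>\<^bsub>M\<^esub> tensor_pow M A n"

primrec matrix_pow :: "complex^'m^'m \<Rightarrow> nat \<Rightarrow> complex^'m^'m" where
  "matrix_pow A 0 = mat 1"
| "matrix_pow A (Suc n) = A ** matrix_pow A n"

definition conj_transpose :: "complex^'n^'m \<Rightarrow> complex^'m^'n" where
  "conj_transpose A = (\<chi> i j. cnj (A $ j $ i))"

definition tensor_conj_transpose ::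
    "complex^'p^'p \<Rightarrow> complex^'p^'n^'m \<Rightarrow> complex^'p^'m^'n" where
  "tensor_conj_transpose M A = (THE C. \<forall>i. tslice M C i = conj_transpose (tslice M A i))"

definition tensor_range :: "complex^'p^'p \<Rightarrow> complex^'p^'n^'m \<Rightarrow> (complex^'p^1^'m) set" where
  "tensor_range M A = {A \<star>\<^bsub>M\<^esub> Z | Z :: complex^'p^1^'n. True}"

definition matrix_index :: "complex^'m^'m \<Rightarrow> nat" where
  "matrix_index A = (LEAST k. rank (matrix_pow A k) = rank (matrix_pow A (k + 1)))"

definition tubal_index :: "complex^'p^'p \<Rightarrow> complex^'p^'m^'m \<Rightarrow> nat" where
  "tubal_index M A = Max (range (\<lambda>i. matrix_index (tslice M A i)))"

definition drazin_inverse :: "complex^'p^'p \<Rightarrow> complex^'p^'m^'m \<Rightarrow> complex^'p^'m^'m" where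
  "drazin_inverse M A = (THE X.
      X \<star>\<^bsub>M\<^esub> A \<star>\<^bsub>M\<^esub> X = X \<and>
      A \<star>\<^bsub>M\<^esub> X = X \<star>\<^bsub>M\<^esub> A \<and>
      X \<star>\<^bsub>M\<^esub> tensor_pow M A (tubal_index M A + 1) = tensor_pow M A (tubal_index M A))"

definition mp_inverse :: "complex^'p^'p \<Rightarrow> complex^'p^'n^'m \<Rightarrow> complex^'p^'m^'n" where
  "mp_inverse M A = (THE X.
      A \<star>\<^bsub>M\<^esub> X \<star>\<^bsub>M\<^esub> A = A \<and>
      X \<star>\<^bsub>M\<^esub> A \<star>\<^bsub>M\<^esub> X = X \<and>
      tensor_conj_transpose M (A \<star>\<^bsub>M\<^esub> X) = A \<star>\<^bsub>M\<^esub> X \<and>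
      tensor_conj_transpose M (X \<star>\<^bsub>M\<^esub> A) = X \<star>\<^bsub>M\<^esub> A)"

definition cmp_inverse :: "complex^'p^'p \<Rightarrow> complex^'p^'m^'m \<Rightarrow> complex^'p^'m^'m" where
  "cmp_inverse M A =
     mp_inverse M A \<star>\<^bsub>M\<^esub> A \<star>\<^bsub>M\<^esub> drazin_inverse M A \<star>\<^bsub>M\<^esub> A \<star>\<^bsub>M\<^esub> mp_inverse M A"

end

theory Submission
  imports Defs
begin

text \<open>
  Write \<open>P\<close> for the Moore--Penrose inverse of \<open>A\<close>, \<open>D\<close> for its Drazin inverse and \<open>N\<close> for
  \<open>A\<close> to the power of the tubal index.  The Drazin equations give \<open>A D N = N\<close>, so the columns
  of \<open>N\<close> lie in the range of \<open>A\<close>, where \<open>A P\<close> acts as the identity: \<open>A P N = A P A D N = A D N = N\<close>.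
  Hence the CMP inverse agrees with \<open>P\<close> on the range of \<open>N\<close>, since
  \<open>(P A D A P) N = P (A D N) = P N\<close> (lemma \<open>matrix_cmp_power\<close>).  For \<open>B = N Z\<close> the candidate
  solution is therefore \<open>P N Z\<close>, which solves the equation and lies in the range of \<open>P N\<close>.
  Conversely, if \<open>P N W\<close> solves it, then \<open>B = A P N W = N W\<close>, so \<open>P N W = P B\<close>
  is the candidate.

  The substance is that \<open>P\<close> and \<open>D\<close>, which are given by definite descriptions, really satisfy their
  defining equations.  The transform identifies a tensor with an arbitrary family
  of frontal slices and turns every operation into the slicewise matrix operation, so unique
  existence for tensors reduces to unique existence for complex square matrices
  (lemma \<open>ex1_tensor_slicewise\<close>).  For matrices, both inverses are built from an inner inverse,
  that is a \<open>G\<close> with \<open>A G A = A\<close>, which exists for any matrix over a field.  For the Drazin inverse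
  this rests on the fact that beyond the index \<open>k\<close> all powers of \<open>A\<close> are left and right
  multiples of one another (lemma \<open>matrix_pow_factors\<close>); a slice may have index smaller than the
  tubal index, so the Drazin theory is developed for every exponent \<open>K \<ge> k\<close>.
\<close>

section \<open>Generalised inverses and rank over a field\<close>

text \<open>A linear map has a linear section on its range, extended to the whole space.\<close>

lemma inner_inverse_exists:
  fixes A :: "'a::field^'n^'m"
  shows "\<exists>G :: 'a^'m^'n. A ** G ** A = A"
proof -
  obtain g where g: "Vector_Spaces.linear (*s) (*s) g" "\<And>x. A *v (g (A *v x)) = A *v x"
    using vec.linear_exists_right_inverse_on[of "(*v) A" UNIV] matrix_vector_mul_linear_gen[of A]
    by auto
  have "A ** matrix g ** A = A"
    unfolding matrix_eq
    using g matrix_works[OF g(1)] by (simp add: matrix_vector_mul_assoc[symmetric])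
  then show ?thesis by blast
qed

text \<open>
  If \<open>G\<close> is an inner inverse of \<open>B\<close>, then \<open>B G\<close> is a projection onto the range of \<open>B\<close>, so it fixes
  the columns of \<open>A\<close> and \<open>U = G A\<close> works.
\<close>

lemma factor_through_range:
  fixes A :: "'a::field^'n^'m" and B :: "'a^'l^'m"
  assumes "range ((*v) A) \<subseteq> range ((*v) B)"
  shows "\<exists>U. A = B ** U"
proof -
  obtain G where G: "B ** G ** B = B" using inner_inverse_exists by blast
  have "B *v (G *v (A *v x)) = A *v x" for x
  proof -
    obtain y where y: "A *v x = B *v y" using assms by blast
    show ?thesis unfolding y using G by (simp add: matrix_vector_mul_assoc matrix_mul_assoc)
  qed
  then have "A = B ** (G ** A)"
    unfolding matrix_eq by (simp add: matrix_vector_mul_assoc[symmetric])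
  then show ?thesis by blast
qed

lemma row_matrix_mul: "row i (X ** Y) = row i X v* Y"
  by (simp add: row_def matrix_matrix_mult_def vector_matrix_mult_def vec_eq_iff)

lemma vector_matrix_mul_in_span_rows:
  fixes Y :: "'a::field^'n^'m"
  shows "x v* Y \<in> vec.span (rows Y)"
proof -
  have "x v* Y = (\<Sum>i\<in>UNIV. x $ i *s row i Y)"
    by (simp add: vec_eq_iff vector_matrix_mult_def row_def mult.commute)
  also have "\<dots> \<in> vec.span (rows Y)"
    by (intro vec.span_sum vec.span_scale vec.span_base) (auto simp: rows_def)
  finally show ?thesis .
qed

lemma rows_matrix_mul_subset: 
  fixes Y :: "'a::field^'n^'m"
  shows "rows (X ** Y) \<subseteq> vec.span (rows Y)"
  using vector_matrix_mul_in_span_rows by (auto simp: rows_def row_matrix_mul)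

lemma rank_matrix_mul_le:
  fixes Y :: "'a::field^'n^'m"
  shows "rank (X ** Y) \<le> rank Y"
  unfolding row_rank_def_gen by (rule vec.dim_mono[OF rows_matrix_mul_subset])

text \<open>
  The rank is by definition the dimension of the row space.  Equal ranks thus force
  \<open>X Y\<close> and \<open>Y\<close> to have the same row space, and for an inner inverse \<open>G\<close> of \<open>X Y\<close> the right action of
  \<open>G X Y\<close> fixes it.
\<close>

lemma left_factor_if_rank_eq:
  fixes X :: "'a::field^'m^'l" and Y :: "'a^'n^'m"
  assumes "rank (X ** Y) = rank Y"
  shows "\<exists>V. Y = V ** (X ** Y)"
proof -
  let ?Z = "X ** Y"
  obtain G where G: "?Z ** G ** ?Z = ?Z" using inner_inverse_exists by blast
  let ?F = "{v. v v* (G ** ?Z) = v}"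
  have sub: "vec.subspace ?F"
    by (simp add: vec.subspace_def scalar_vector_matrix_assoc vector_matrix_left_distrib)
  have "rows ?Z \<subseteq> ?F"
    using G by (auto simp: rows_def row_matrix_mul[symmetric] matrix_mul_assoc)
  then have "vec.span (rows ?Z) \<subseteq> ?F" using sub by (rule vec.span_minimal)
  moreover have "vec.span (rows ?Z) = vec.span (rows Y)"
    using assms rows_matrix_mul_subset[of X Y] unfolding row_rank_def_gen
    by (intro vec.subspace_dim_equal) (auto simp: vec.span_minimal)
  ultimately have "row i Y v* (G ** ?Z) = row i Y" for i
    using vec.span_base[of "row i Y" "rows Y"] by (auto simp: rows_def)
  then have "Y = Y ** (G ** ?Z)"
    by (simp add: row_matrix_mul[symmetric]) (simp add: row_def vec_eq_iff)
  then show ?thesis by (metis matrix_mul_assoc)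
qed

section \<open>Powers and the matrix index\<close>

lemma matrix_pow_add: "matrix_pow A (m + n) = matrix_pow A m ** matrix_pow A n"
  by (induction m) (simp_all add: matrix_mul_assoc)

lemma matrix_pow_commute: "matrix_pow A n ** A = A ** matrix_pow A n"
  by (induction n) (simp_all add: matrix_mul_assoc[symmetric])

text \<open>
  The ranks of the successive powers decrease, so they cannot decrease strictly forever; the
  minimum defining the index is therefore attained.
\<close>

lemma matrix_index_rank:
  "rank (matrix_pow A (matrix_index A)) = rank (matrix_pow A (matrix_index A + 1))"
proof -
  let ?r = "\<lambda>k. rank (matrix_pow A k)"
  have "\<exists>k. ?r k = ?r (k + 1)"
  proof (rule ccontr)
    assume no: "\<nexists>k. ?r k = ?r (k + 1)"
    have dec: "?r (Suc k) < ?r k" for k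
      using no rank_matrix_mul_le[of A "matrix_pow A k"] by (metis Suc_eq_plus1 le_neq_implies_less matrix_pow.simps(2))
    have "?r k + k \<le> ?r 0" for k
    proof (induction k)
      case (Suc k)
      then show ?case using dec[of k] by linarith
    qed simp
    from this[of "Suc (?r 0)"] show False by simp
  qed
  then show ?thesis unfolding matrix_index_def by (rule LeastI_ex)
qed

text \<open>
  At the index \<open>j\<close>, equality of ranks gives the left factorisation through row spaces.  It
  also makes \<open>A\<close> injective on the range of its \<open>j\<close>-th power, which \<open>A\<close> maps into itself;
  by finite dimension \<open>A\<close> is onto this range, and that is the right factorisation.
  Multiplying by further powers of \<open>A\<close> and iterating reaches all larger exponents.
\<close>

lemma matrix_pow_factors:
  assumes "matrix_index A \<le> K"
  shows "\<exists>U. matrix_pow A K = matrix_pow A (K + n) ** U"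
    and "\<exists>V. matrix_pow A K = V ** matrix_pow A (K + n)"
proof -
  let ?P = "matrix_pow A"
  define j where "j = matrix_index A"
  obtain V where V: "?P j = V ** ?P (Suc j)"
    using left_factor_if_rank_eq[of A "?P j"] matrix_index_rank[of A] unfolding j_def by auto
  let ?S = "range ((*v) (?P j))"
  have subS: "vec.subspace ?S"
    by (rule vec.linear_subspace_image[OF matrix_vector_mul_linear_gen vec.subspace_UNIV])
  have inj: "inj_on ((*v) A) ?S"
  proof (rule inj_onI)
    fix x y assume "x \<in> ?S" "y \<in> ?S" and eq: "A *v x = A *v y"
    then obtain a b where ab: "x = ?P j *v a" "y = ?P j *v b" by blast
    have "V *v (A *v (?P j *v c)) = ?P j *v c" for c
      by (subst (2) V) (simp add: matrix_vector_mul_assoc matrix_mul_assoc)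
    with eq ab show "x = y" by metis
  qed
  have AS: "(*v) A ` ?S = range ((*v) (?P (Suc j)))"
    by (simp add: image_image matrix_vector_mul_assoc)
  have "(*v) A ` ?S = ?S"
  proof (rule vec.subspace_dim_equal)
    show "(*v) A ` ?S \<subseteq> ?S"
      unfolding AS by (auto simp: matrix_pow_commute[symmetric] matrix_vector_mul_assoc[symmetric])
    show "vec.dim ?S \<le> vec.dim ((*v) A ` ?S)"
      using vec.dim_image_eq[OF matrix_vector_mul_linear_gen, of A ?S] inj
      by (simp add: vec.span_eq_iff[THEN iffD2, OF subS])
    show "vec.subspace ((*v) A ` ?S)"
      by (rule vec.linear_subspace_image[OF matrix_vector_mul_linear_gen subS])
  qed (rule subS)
  then obtain U where U: "?P j = ?P (Suc j) ** U"
    using factor_through_range[of "?P j" "?P (Suc j)"] AS by auto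
  have stepU: "?P L = ?P (Suc L) ** U" if L: "j \<le> L" for L
  proof -
    obtain d where d: "L = d + j" using le_Suc_ex[OF L] by (auto simp: add.commute)
    have "?P L = ?P d ** (?P (Suc j) ** U)" unfolding d matrix_pow_add U[symmetric] ..
    also have "\<dots> = ?P (d + Suc j) ** U" unfolding matrix_pow_add by (rule matrix_mul_assoc)
    finally show ?thesis by (simp add: d)
  qed
  have stepV: "?P L = V ** ?P (Suc L)" if L: "j \<le> L" for L
  proof -
    obtain d where d: "L = j + d" using le_Suc_ex[OF L] by blast
    have "?P L = (V ** ?P (Suc j)) ** ?P d" unfolding d matrix_pow_add V[symmetric] ..
    also have "\<dots> = V ** ?P (Suc j + d)"
      unfolding matrix_pow_add by (rule matrix_mul_assoc[symmetric])
    finally show ?thesis by (simp add: d)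
  qed
  have jK: "j \<le> K + n" for n using assms by (simp add: j_def)
  show "\<exists>U. ?P K = ?P (K + n) ** U"
  proof (induction n)
    case 0 show ?case by (rule exI[of _ "mat 1"]) simp
  next
    case (Suc n)
    then obtain W where "?P K = ?P (K + n) ** W" by blast
    then have "?P K = ?P (K + Suc n) ** (U ** W)"
      using stepU[OF jK, of n] by (simp only: add_Suc_right matrix_mul_assoc)
    then show ?case by blast
  qed
  show "\<exists>V. ?P K = V ** ?P (K + n)"
  proof (induction n)
    case 0 show ?case by (rule exI[of _ "mat 1"]) simp
  next
    case (Suc n)
    then obtain W where "?P K = W ** ?P (K + n)" by blast
    then have "?P K = (W ** V) ** ?P (K + Suc n)"
      using stepV[OF jK, of n] by (simp only: add_Suc_right matrix_mul_assoc[symmetric])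
    then show ?case by blast
  qed
qed

section \<open>The Drazin inverse of a matrix\<close>

text \<open>
  The exponent \<open>K\<close> is a parameter because the slices of a tensor share the tubal index, which
  may exceed their individual indices.
\<close>

definition is_drazin :: "nat \<Rightarrow> complex^'m^'m \<Rightarrow> complex^'m^'m \<Rightarrow> bool" where
  "is_drazin K A X \<longleftrightarrow> X ** A ** X = X \<and> A ** X = X ** A \<and>
     X ** matrix_pow A (K + 1) = matrix_pow A K"

text \<open>
  The witness is \<open>N G N\<close> with \<open>N\<close> the \<open>K\<close>-th power of \<open>A\<close> and \<open>G\<close> an inner inverse of the power
  \<open>2 K + 1\<close>.  Since \<open>N\<close> is a left and a right multiple of that power, \<open>G\<close> can be cancelled,
  and the witness undoes one factor \<open>A\<close> of the \<open>(K + 1)\<close>-th power from either side.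
\<close>

lemma drazin_exists:
  assumes "matrix_index A \<le> K"
  shows "\<exists>X. is_drazin K A X"
proof -
  let ?P = "matrix_pow A"
  let ?Q = "?P (K + Suc K)"
  obtain U where U: "?P K = ?Q ** U" using matrix_pow_factors(1)[OF assms] by blast
  obtain V where V: "?P K = V ** ?Q" using matrix_pow_factors(2)[OF assms] by blast
  obtain G where G: "?Q ** G ** ?Q = ?Q" using inner_inverse_exists by blast
  define D where "D = ?P K ** G ** ?P K"
  have "D ** ?P (Suc K) = V ** (?Q ** G ** ?Q)"
  proof -
    have "D ** ?P (Suc K) = (V ** ?Q) ** G ** (?P K ** ?P (Suc K))"
      unfolding D_def V[symmetric] by (simp add: matrix_mul_assoc del: matrix_pow.simps)
    also have "?P K ** ?P (Suc K) = ?Q" by (rule matrix_pow_add[symmetric])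
    finally show ?thesis by (simp add: matrix_mul_assoc)
  qed
  then have l: "D ** ?P (Suc K) = ?P K" using G V by simp
  have "?P (Suc K) ** D = (?Q ** G ** ?Q) ** U"
  proof -
    have "?P (Suc K) ** D = (?P (Suc K) ** ?P K) ** G ** (?Q ** U)"
      unfolding D_def U[symmetric] by (simp add: matrix_mul_assoc del: matrix_pow.simps)
    also have "?P (Suc K) ** ?P K = ?Q" by (metis add.commute matrix_pow_add)
    finally show ?thesis by (simp add: matrix_mul_assoc)
  qed
  then have r: "?P (Suc K) ** D = ?P K" using G U by simp
  \<comment> \<open>Rewriting the \<open>K\<close>-th power of \<open>A\<close> by \<open>l\<close> on the left, respectively by \<open>r\<close> on the right, brings
    \<open>A D\<close> and \<open>D A\<close> to the same form \<open>D A A D\<close>.\<close>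
  have "A ** D = D ** (A ** A) ** D"
  proof -
    have "A ** ?P K = ?P K ** A" by (simp add: matrix_pow_commute)
    also have "\<dots> = D ** ?P (Suc K) ** A" by (simp only: l)
    also have "\<dots> = D ** (A ** A) ** ?P K"
      by (simp add: matrix_mul_assoc[symmetric] matrix_pow_commute)
    finally have "A ** ?P K ** G ** ?P K = D ** (A ** A) ** (?P K ** G ** ?P K)"
      by (simp add: matrix_mul_assoc)
    then show ?thesis by (simp add: D_def matrix_mul_assoc)
  qed
  moreover have "D ** A = D ** (A ** A) ** D"
  proof -
    have "?P K ** A = A ** (?P (Suc K) ** D)" by (simp only: r matrix_pow_commute)
    also have "\<dots> = ?P K ** (A ** A) ** D"
      by (metis matrix_mul_assoc matrix_pow_commute matrix_pow.simps(2))
    finally have "?P K ** G ** (?P K ** A) = ?P K ** G ** (?P K ** (A ** A) ** D)" by simp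
    then show ?thesis by (simp add: D_def matrix_mul_assoc)
  qed
  ultimately have c: "A ** D = D ** A" by simp
  have "D ** A ** D = (D ** ?P (Suc K)) ** G ** ?P K"
    by (simp add: D_def matrix_mul_assoc)
  also have "\<dots> = D" unfolding l by (simp add: D_def)
  finally show ?thesis using l c unfolding is_drazin_def by (auto simp del: matrix_pow.simps)
qed

text \<open>
  \<open>A X\<close> is idempotent and its factors commute, so it equals its own \<open>n\<close>-th power, in which the
  factors \<open>A\<close> can be collected on either side.
\<close>

lemma drazin_idempotent_factors:
  assumes "X ** A ** X = X" "A ** X = X ** A"
  shows "\<exists>W. A ** X = matrix_pow A n ** W" "\<exists>W. A ** X = W ** matrix_pow A n"
proof -
  show "\<exists>W. A ** X = matrix_pow A n ** W"
  proof (induction n)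
    case 0 show ?case by (rule exI[of _ "A ** X"]) simp
  next
    case (Suc n)
    then obtain W where W: "A ** X = matrix_pow A n ** W" by blast
    have "A ** X = A ** (X ** A ** X)" using assms(1) by simp
    also have "\<dots> = A ** (A ** X) ** X" using assms(2) by (simp add: matrix_mul_assoc)
    also have "\<dots> = matrix_pow A (Suc n) ** (W ** X)" unfolding W by (simp add: matrix_mul_assoc)
    finally show ?case by blast
  qed
  show "\<exists>W. A ** X = W ** matrix_pow A n"
  proof (induction n)
    case 0 show ?case by (rule exI[of _ "A ** X"]) simp
  next
    case (Suc n)
    then obtain W where W: "A ** X = W ** matrix_pow A n" by blast
    have "A ** X = (X ** A ** X) ** A" using assms by simp
    also have "\<dots> = X ** (A ** X) ** A" by (simp add: matrix_mul_assoc)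
    also have "\<dots> = (X ** W) ** matrix_pow A (Suc n)" unfolding W
      by (simp add: matrix_mul_assoc[symmetric] matrix_pow_commute)
    finally show ?case by blast
  qed
qed

text \<open>
  For any solution \<open>Z\<close> the idempotent \<open>A Z\<close> fixes the \<open>K\<close>-th power of \<open>A\<close> from both sides, and it is
  a left and right multiple of that power.  Hence the idempotents of two solutions absorb
  each other and coincide, and the idempotent determines the solution.
\<close>

lemma drazin_unique:
  assumes X: "is_drazin K A X" and Y: "is_drazin K A Y"
  shows "X = Y"
proof -
  let ?P = "matrix_pow A"
  have fixed: "A ** Z ** ?P K = ?P K" "?P K ** (A ** Z) = ?P K" if Z: "is_drazin K A Z" for Z
  proof -
    have c: "A ** Z = Z ** A" and p: "Z ** (A ** ?P K) = ?P K"
      using Z by (auto simp: is_drazin_def)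
    show 1: "A ** Z ** ?P K = ?P K" using c p by (simp add: matrix_mul_assoc)
    have "?P n ** (A ** Z) = A ** Z ** ?P n" for n
    proof (induction n)
      case (Suc n)
      have "?P (Suc n) ** (A ** Z) = A ** (A ** Z ** ?P n)"
        using Suc by (simp add: matrix_mul_assoc[symmetric])
      also have "\<dots> = A ** Z ** ?P (Suc n)" by (metis c matrix_mul_assoc matrix_pow.simps(2))
      finally show ?case .
    qed simp
    then show "?P K ** (A ** Z) = ?P K" using 1 by simp
  qed
  have absorb: "A ** Y ** (A ** X) = A ** X" "A ** X ** (A ** Y) = A ** X"
    if X: "is_drazin K A X" and Y: "is_drazin K A Y" for X Y
  proof -
    have e: "X ** A ** X = X" "A ** X = X ** A" using X by (auto simp: is_drazin_def)
    obtain W where W: "A ** X = ?P K ** W" using drazin_idempotent_factors(1)[OF e] by blast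
    obtain W' where W': "A ** X = W' ** ?P K" using drazin_idempotent_factors(2)[OF e] by blast
    show "A ** Y ** (A ** X) = A ** X"
      unfolding W by (metis fixed(1)[OF Y] matrix_mul_assoc)
    show "A ** X ** (A ** Y) = A ** X"
      unfolding W' by (metis fixed(2)[OF Y] matrix_mul_assoc)
  qed
  have e: "A ** X = A ** Y" using absorb(1)[OF X Y] absorb(2)[OF Y X] by simp
  have "X = X ** (A ** X)" using X unfolding is_drazin_def by (metis matrix_mul_assoc)
  also have "\<dots> = X ** (A ** Y)" unfolding e ..
  also have "\<dots> = A ** X ** Y" using X by (simp add: is_drazin_def matrix_mul_assoc)
  also have "\<dots> = Y" using Y e by (simp add: is_drazin_def)
  finally show ?thesis .
qed

section \<open>The Moore--Penrose inverse of a matrix\<close>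

definition is_mp :: "complex^'n^'m \<Rightarrow> complex^'m^'n \<Rightarrow> bool" where
  "is_mp A X \<longleftrightarrow> A ** X ** A = A \<and> X ** A ** X = X \<and>
     conj_transpose (A ** X) = A ** X \<and> conj_transpose (X ** A) = X ** A"

lemma conj_transpose_conj_transpose [simp]: "conj_transpose (conj_transpose A) = A"
  by (simp add: conj_transpose_def vec_eq_iff)

lemma conj_transpose_mul: "conj_transpose (A ** B) = conj_transpose B ** conj_transpose A"
  by (simp add: conj_transpose_def vec_eq_iff matrix_matrix_mult_def mult.commute)

text \<open>The diagonal entries of the Gram matrix are the squared norms of the columns.\<close>

lemma gram_eq_0: 
  assumes "conj_transpose A ** A = 0"
  shows "A = 0"
proof -
  have "A $ i $ j = 0" for i j
  proof -
    have "(\<Sum>i\<in>UNIV. cnj (A $ i $ j) * A $ i $ j) = (conj_transpose A ** A) $ j $ j"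
      by (simp add: conj_transpose_def matrix_matrix_mult_def)
    also have "\<dots> = 0" using assms by simp
    finally have "(\<Sum>i\<in>UNIV. complex_of_real ((cmod (A $ i $ j))\<^sup>2)) = 0"
      by (simp add: complex_norm_square mult.commute del: of_real_power)
    then have "(\<Sum>i\<in>UNIV. (cmod (A $ i $ j))\<^sup>2) = 0"
      by (metis of_real_eq_0_iff of_real_sum)
    then show ?thesis by (simp add: sum_nonneg_eq_0_iff)
  qed
  then show ?thesis by (simp add: vec_eq_iff)
qed

lemma matrix_sub_ldistrib:
  fixes A :: "'a::ring_1^'n^'m"
  shows "A ** (X - Y) = A ** X - A ** Y"
  by (simp add: matrix_matrix_mult_def vec_eq_iff right_diff_distrib sum_subtractf)

lemma gram_cancel:
  fixes A :: "complex^'n^'m" and X Y :: "complex^'l^'n"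
  assumes "conj_transpose A ** A ** X = conj_transpose A ** A ** Y"
  shows "A ** X = A ** Y"
proof -
  have "conj_transpose A ** (A ** (X - Y)) = 0"
    using assms by (simp add: matrix_sub_ldistrib matrix_mul_assoc)
  then have "conj_transpose (A ** (X - Y)) ** (A ** (X - Y)) = 0"
    by (simp add: conj_transpose_mul matrix_mul_assoc[symmetric])
  then have "A ** (X - Y) = 0" by (rule gram_eq_0)
  then show ?thesis by (simp add: matrix_sub_ldistrib)
qed

text \<open>
  Take \<open>X = G A\<^sup>*\<close> with \<open>G\<close> an inner inverse of the Gram matrix \<open>H = A\<^sup>* A\<close>.  Cancelling \<open>A\<^sup>*\<close> in
  \<open>H G H = H\<close> gives \<open>A X A = A\<close>.  As \<open>H\<close> is Hermitian, \<open>G\<^sup>*\<close> is an inner inverse too, and the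
  same cancellation for it gives \<open>H X = A\<^sup>*\<close>.  Therefore \<open>(A X)\<^sup>* = X\<^sup>* H X\<close>, which is Hermitian.
\<close>

lemma least_squares_inverse_exists:
  fixes A :: "complex^'n^'m"
  shows "\<exists>X. A ** X ** A = A \<and> conj_transpose (A ** X) = A ** X"
proof -
  let ?H = "conj_transpose A ** A"
  obtain G where G: "?H ** G ** ?H = ?H" using inner_inverse_exists by blast
  have inner: "A ** G ** ?H = A" if "?H ** G ** ?H = ?H" for G
    using gram_cancel[of A "G ** ?H" "mat 1"] that by (simp add: matrix_mul_assoc)
  have "?H ** conj_transpose G ** ?H = conj_transpose (?H ** G ** ?H)"
    by (simp add: conj_transpose_mul matrix_mul_assoc)
  then have "?H ** conj_transpose G ** ?H = ?H"
    unfolding G by (simp add: conj_transpose_mul)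
  from inner[OF this] have "conj_transpose (A ** conj_transpose G ** ?H) = conj_transpose A" by simp
  then have n: "?H ** G ** conj_transpose A = conj_transpose A"
    by (simp add: conj_transpose_mul matrix_mul_assoc)
  define X where "X = G ** conj_transpose A"
  have "conj_transpose (A ** X) = conj_transpose X ** (?H ** X)"
    using n by (simp add: conj_transpose_mul X_def matrix_mul_assoc)
  then have "conj_transpose (A ** X) = conj_transpose (A ** X) ** (A ** X)"
    by (simp add: conj_transpose_mul matrix_mul_assoc)
  then have "conj_transpose (A ** X) = A ** X"
    by (metis conj_transpose_mul conj_transpose_conj_transpose)
  moreover have "A ** X ** A = A" using inner[OF G] by (simp add: X_def matrix_mul_assoc)
  ultimately show ?thesis by blast
qed

text \<open>
  If \<open>A X\<close> and \<open>Y A\<close> are Hermitian for inner inverses \<open>X\<close> and \<open>Y\<close> (the latter obtained from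
  \<open>A\<^sup>*\<close>), then \<open>Y A X\<close> has both properties at once: \<open>A (Y A X) = A X\<close> and \<open>(Y A X) A = Y A\<close>.
\<close>

lemma mp_exists: "\<exists>X. is_mp A X"
proof -
  obtain X where X: "A ** X ** A = A" "conj_transpose (A ** X) = A ** X"
    using least_squares_inverse_exists by blast
  obtain Z where Z: "conj_transpose A ** Z ** conj_transpose A = conj_transpose A"
     "conj_transpose (conj_transpose A ** Z) = conj_transpose A ** Z"
    using least_squares_inverse_exists by blast
  define Y where "Y = conj_transpose Z"
  have Y: "A ** Y ** A = A" "conj_transpose (Y ** A) = Y ** A"
    using arg_cong[OF Z(1), of conj_transpose] arg_cong[OF Z(2), of conj_transpose]
    by (simp_all add: Y_def conj_transpose_mul matrix_mul_assoc)
  let ?P = "Y ** A ** X"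
  have AP: "A ** ?P = A ** X" using Y by (simp add: matrix_mul_assoc)
  have PA: "?P ** A = Y ** A" using X by (simp add: matrix_mul_assoc[symmetric])
  have "?P ** A ** ?P = ?P" unfolding PA using Y(1) by (metis matrix_mul_assoc)
  then have "is_mp A ?P" unfolding is_mp_def AP PA using X Y by simp
  then show ?thesis by blast
qed

text \<open>
  \<open>A X\<close> and \<open>A Y\<close> are Hermitian projections that absorb each other, so taking adjoints of
  \<open>A Y = (A X) (A Y)\<close> gives \<open>A Y = A X\<close>; likewise \<open>X A = Y A\<close>.
\<close>

lemma mp_unique:
  assumes X: "is_mp A X" and Y: "is_mp A Y"
  shows "X = Y"
proof -
  have "A ** Y = A ** X ** (A ** Y)" using X by (simp add: is_mp_def matrix_mul_assoc)
  then have "conj_transpose (A ** Y) = conj_transpose (A ** Y) ** conj_transpose (A ** X)"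
    by (metis conj_transpose_mul)
  then have "A ** Y = A ** Y ** (A ** X)" using X Y by (simp add: is_mp_def)
  then have AXY: "A ** Y = A ** X" using Y by (simp add: is_mp_def matrix_mul_assoc)
  have "X ** A = X ** A ** (Y ** A)"
    using Y by (simp add: is_mp_def matrix_mul_assoc[symmetric])
  then have "conj_transpose (X ** A) = conj_transpose (Y ** A) ** conj_transpose (X ** A)"
    by (metis conj_transpose_mul)
  then have "X ** A = Y ** A ** (X ** A)" using X Y by (simp add: is_mp_def)
  also have "\<dots> = Y ** A" using X by (simp add: is_mp_def matrix_mul_assoc[symmetric])
  finally have XYA: "X ** A = Y ** A" .
  have "X = X ** A ** X" using X by (simp add: is_mp_def)
  also have "\<dots> = Y ** (A ** X)" unfolding XYA by (simp add: matrix_mul_assoc)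
  also have "\<dots> = Y" unfolding AXY[symmetric] using Y by (simp add: is_mp_def matrix_mul_assoc)
  finally show ?thesis .
qed

section \<open>Tensors as families of frontal slices\<close>

text \<open>The transform applies \<open>M\<close> to every tube, which is why it is invertible with \<open>M\<close>.\<close>

lemma tslice_matrix_vector: "tslice M C k $ i $ j = (M *v (C $ i $ j)) $ k"
  by (simp add: frontal_slice_def mtransform_def matrix_vector_mult_def mult.commute)

lemma tensor_eqI:
  assumes "invertible M" and "\<And>k. tslice M C k = tslice M D k"
  shows "C = D"
proof -
  obtain N where N: "N ** M = mat 1" using assms(1) by (auto simp: invertible_def)
  have "M *v (C $ i $ j) = M *v (D $ i $ j)" for i j
    using assms(2) by (simp add: vec_eq_iff tslice_matrix_vector[symmetric])
  then have "C $ i $ j = D $ i $ j" for i j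
    by (metis N matrix_vector_mul_assoc matrix_vector_mul_lid)
  then show ?thesis by (simp add: vec_eq_iff)
qed

lemma tensor_of_slices:
  fixes M :: "complex^'p^'p" and F :: "'p \<Rightarrow> complex^'n^'m"
  assumes "invertible M"
  shows "\<exists>C. \<forall>k. tslice M C k = F k"
proof -
  obtain N where N: "M ** N = mat 1" using assms by (auto simp: invertible_def)
  let ?C = "\<chi> i j. N *v (\<chi> k. F k $ i $ j)"
  have "tslice M ?C k = F k" for k
    by (simp add: vec_eq_iff[of "tslice M _ k"] vec_eq_iff[of "_ $ _" "F k $ _"]
        tslice_matrix_vector matrix_vector_mul_assoc N)
  then show ?thesis by blast
qed

text \<open>
  Slices can be prescribed freely and determine the tensor, so a slicewise condition that
  determines each slice determines a unique tensor.  This discharges every definite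
  description for tensors.
\<close>

lemma ex1_tensor_slicewise:
  fixes M :: "complex^'p^'p" and P :: "'p \<Rightarrow> complex^'n^'m \<Rightarrow> bool"
  assumes "invertible M" and "\<And>k. \<exists>!x. P k x"
  shows "\<exists>!C. \<forall>k. P k (tslice M C k)"
proof -
  obtain C where "\<forall>k. tslice M C k = (THE x. P k x)" 
    using tensor_of_slices[OF assms(1), of "\<lambda>k. THE x. P k x"] by blast
  then have "\<forall>k. P k (tslice M C k)" using theI'[OF assms(2)] by simp
  then show ?thesis using assms(2) tensor_eqI[OF assms(1)] by metis
qed

lemma tslice_mprod:
  assumes "invertible M"
  shows "tslice M (A \<star>\<^bsub>M\<^esub> B) k = tslice M A k ** tslice M B k"
proof -
  have "\<exists>!C. \<forall>k. tslice M C k = tslice M A k ** tslice M B k"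
    by (rule ex1_tensor_slicewise[OF assms]) simp
  from theI'[OF this] show ?thesis by (simp add: mprod_def)
qed

lemma tslice_tensor_id:
  assumes "invertible M"
  shows "tslice M (tensor_id M) k = (mat 1 :: complex^'m^'m)"
proof -
  have "\<exists>!C. \<forall>k. tslice M C k = (mat 1 :: complex^'m^'m)"
    by (rule ex1_tensor_slicewise[OF assms]) simp
  from theI'[OF this] show ?thesis by (simp add: tensor_id_def)
qed

lemma tslice_conj_transpose:
  assumes "invertible M"
  shows "tslice M (tensor_conj_transpose M A) k = conj_transpose (tslice M A k)"
proof -
  have "\<exists>!C. \<forall>k. tslice M C k = conj_transpose (tslice M A k)"
    by (rule ex1_tensor_slicewise[OF assms]) simp
  from theI'[OF this] show ?thesis by (simp add: tensor_conj_transpose_def)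
qed

lemma tslice_tensor_pow:
  assumes "invertible M"
  shows "tslice M (tensor_pow M A n) k = matrix_pow (tslice M A k) n"
  by (induction n) (simp_all add: tslice_mprod tslice_tensor_id assms)

lemma tensor_eq_iff:
  assumes "invertible M"
  shows "C = D \<longleftrightarrow> (\<forall>k. tslice M C k = tslice M D k)"
  using tensor_eqI[OF assms] by blast

lemmas tslice_simps = tslice_mprod tslice_tensor_id tslice_conj_transpose tslice_tensor_pow

lemma mprod_assoc:
  assumes "invertible M"
  shows "A \<star>\<^bsub>M\<^esub> (B \<star>\<^bsub>M\<^esub> C) = A \<star>\<^bsub>M\<^esub> B \<star>\<^bsub>M\<^esub> C"
  by (simp add: tensor_eq_iff[OF assms] tslice_mprod[OF assms] matrix_mul_assoc)

lemma matrix_index_le_tubal_index: "matrix_index (tslice M A i) \<le> tubal_index M A"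
  unfolding tubal_index_def by (rule Max_ge) auto

lemma tensor_drazin_inverse:
  assumes "invertible M"
  shows "is_drazin (tubal_index M A) (tslice M A i) (tslice M (drazin_inverse M A) i)"
proof -
  let ?k = "tubal_index M A"
  have "\<exists>!X. \<forall>i. is_drazin ?k (tslice M A i) (tslice M X i)"
    by (rule ex1_tensor_slicewise[OF assms])
      (metis drazin_exists drazin_unique matrix_index_le_tubal_index)
  moreover have "drazin_inverse M A = (THE X. \<forall>i. is_drazin ?k (tslice M A i) (tslice M X i))"
    unfolding drazin_inverse_def is_drazin_def tensor_eq_iff[OF assms]
    by (simp add: tslice_simps[OF assms] all_conj_distrib del: tensor_pow.simps matrix_pow.simps)
  ultimately show ?thesis using theI'[of "\<lambda>X. \<forall>i. is_drazin ?k (tslice M A i) (tslice M X i)"] by simp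
qed

lemma tensor_mp_inverse:
  assumes "invertible M"
  shows "is_mp (tslice M A i) (tslice M (mp_inverse M A) i)"
proof -
  have "\<exists>!X. \<forall>i. is_mp (tslice M A i) (tslice M X i)"
    by (rule ex1_tensor_slicewise[OF assms]) (metis mp_exists mp_unique)
  moreover have "mp_inverse M A = (THE X. \<forall>i. is_mp (tslice M A i) (tslice M X i))"
    unfolding mp_inverse_def is_mp_def tensor_eq_iff[OF assms]
    by (simp add: tslice_simps[OF assms] all_conj_distrib)
  ultimately show ?thesis using theI'[of "\<lambda>X. \<forall>i. is_mp (tslice M A i) (tslice M X i)"] by simp
qed

section \<open>The restricted linear system\<close>

text \<open>
  With \<open>N\<close> the \<open>K\<close>-th power of \<open>A\<close>, the Drazin equations give \<open>N = A D N\<close>.  So the columns of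
  \<open>N\<close> lie in the range of \<open>A\<close>, which \<open>A P\<close> fixes; then \<open>A D\<close> fixes \<open>N\<close> once more.
\<close>

lemma matrix_cmp_power:
  assumes P: "is_mp A P" and D: "is_drazin K A D"
  shows "A ** P ** matrix_pow A K = matrix_pow A K"
    and "P ** A ** D ** A ** P ** matrix_pow A K = P ** matrix_pow A K"
proof -
  let ?N = "matrix_pow A K"
  have c: "A ** D = D ** A" and p: "A ** D ** ?N = ?N" and a: "A ** P ** A = A"
    using P D by (auto simp: is_mp_def is_drazin_def matrix_mul_assoc)
  have "A ** P ** ?N = A ** P ** A ** D ** ?N" using p by (metis matrix_mul_assoc)
  then show 1: "A ** P ** ?N = ?N" unfolding a p .
  have "P ** A ** D ** A ** P ** ?N = P ** (A ** D ** (A ** P ** ?N))"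
    by (simp add: matrix_mul_assoc)
  then show "P ** A ** D ** A ** P ** ?N = P ** ?N" unfolding 1 p .
qed

theorem theorem6p6:
  fixes M :: "complex^'p^'p"
    and A :: "complex^'p^'m^'m"
    and B :: "complex^'p^1^'m"
    and k :: nat
  assumes "invertible M"
    and "tubal_index M A = k"
    and "B \<in> tensor_range M (tensor_pow M A k)"
  shows "cmp_inverse M A \<star>\<^bsub>M\<^esub> B \<in> tensor_range M (mp_inverse M A \<star>\<^bsub>M\<^esub> tensor_pow M A k)
    \<and> A \<star>\<^bsub>M\<^esub> (cmp_inverse M A \<star>\<^bsub>M\<^esub> B) = B
    \<and> (\<forall>X \<in> tensor_range M (mp_inverse M A \<star>\<^bsub>M\<^esub> tensor_pow M A k).
          A \<star>\<^bsub>M\<^esub> X = B \<longrightarrow> X = cmp_inverse M A \<star>\<^bsub>M\<^esub> B)"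
proof -
  note M = assms(1)
  let ?P = "mp_inverse M A" and ?N = "tensor_pow M A k"
  note cmp = matrix_cmp_power[OF tensor_mp_inverse[OF M, of A] tensor_drazin_inverse[OF M, of A],
      unfolded assms(2)]
  have APN: "A \<star>\<^bsub>M\<^esub> ?P \<star>\<^bsub>M\<^esub> ?N = ?N"
    by (simp add: tensor_eq_iff[OF M] tslice_simps[OF M] cmp)
  have CN: "cmp_inverse M A \<star>\<^bsub>M\<^esub> ?N = ?P \<star>\<^bsub>M\<^esub> ?N"
    by (simp add: tensor_eq_iff[OF M] tslice_simps[OF M] cmp cmp_inverse_def)
  obtain Z :: "complex^'p^1^'m" where Z: "B = ?N \<star>\<^bsub>M\<^esub> Z"
    using assms(3) by (auto simp: tensor_range_def)
  have CB: "cmp_inverse M A \<star>\<^bsub>M\<^esub> B = ?P \<star>\<^bsub>M\<^esub> ?N \<star>\<^bsub>M\<^esub> Z"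
    unfolding Z by (simp add: mprod_assoc[OF M] CN)
  have A_range: "A \<star>\<^bsub>M\<^esub> (?P \<star>\<^bsub>M\<^esub> ?N \<star>\<^bsub>M\<^esub> W) = ?N \<star>\<^bsub>M\<^esub> W" for W :: "complex^'p^1^'m"
    by (simp add: mprod_assoc[OF M] APN)
  have "X = cmp_inverse M A \<star>\<^bsub>M\<^esub> B"
    if X: "X \<in> tensor_range M (?P \<star>\<^bsub>M\<^esub> ?N)" and sol: "A \<star>\<^bsub>M\<^esub> X = B" for X
  proof -
    obtain W :: "complex^'p^1^'m" where W: "X = ?P \<star>\<^bsub>M\<^esub> ?N \<star>\<^bsub>M\<^esub> W"
      using X by (auto simp: tensor_range_def)
    then have NW: "B = ?N \<star>\<^bsub>M\<^esub> W" using sol A_range by simp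
    show ?thesis unfolding NW W by (simp add: mprod_assoc[OF M] CN)
  qed
  moreover have "cmp_inverse M A \<star>\<^bsub>M\<^esub> B \<in> tensor_range M (?P \<star>\<^bsub>M\<^esub> ?N)"
    unfolding CB tensor_range_def by blast
  moreover have "A \<star>\<^bsub>M\<^esub> (cmp_inverse M A \<star>\<^bsub>M\<^esub> B) = B"
    unfolding CB A_range by (rule Z[symmetric])
  ultimately show ?thesis by blast
qed

end
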